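(* Let $D=(D_T,D_F)$ be a regular $(s^{n-k}:s^p)$ design. For all integers $t\ge 0$, $$K_{t,1}(D)=s^{-1}\sum_{i=0}^{\min(t,n)} c_t(i;n,s)\,[A_{i,1}(D)+L_p A_{i,0}(D)],$$ where $L_p=(s^p-1)/(s-1)$, $A_{0,0}(D)=1/(s-1)$, and the constants $c_t(i;n,s)$ are defined by $$c_t(i;n,s)=(s-1)\sum_{m=0}^{t}(-1)^m\binom{t}{m}n^{t-m}Q_m(i;n,s),\qquad Q_m(i;n,s)=(-1)^i\sum_{j=0}^{m} j!\,S(m,j)\,s^{-j}(s-1)^{j-i}\binom{n-i}{j-i}.$$
   Context: Let $s$ be a prime power, $GF(s)$ the field with $s$ elements, and $V_m$ the space of row vectors of length $m$ over $GF(s)$. Let $n,k,p$ be integers with $n\ge1$, $k\ge0$, $n-k\ge 1$, $p\ge 1$; write $N=s^{n-k}$ and $L_q=(s^q-1)/(s-1)$. Designs. A regular $s^{n-k}$ design is the $N\times n$ matrix $D_T$ whose rows are the vectors $uT$, $u\in V_{n-k}$, where $T$ is an $(n-k)\times n$ matrix over $GF(s)$ of full row rank. A regular $(s^{n-k}:s^p)$ design $D$ is specified by such a $T$ together with an $(n-k)\times p$ matrix $B$ over $GF(s)$ of full column rank; its blocks are the sets $\{uT: u\in V_{n-k},\,uB=v\}$, one for each $v\in V_p$. If $b_1,\dots,b_p$ are the columns of $B$, let $F$ be the $(n-k)\times L_p$ matrix whose columns are all combinations $\lambda_1b_1+\cdots+\lambda_pb_p$ with $\lambda_i\in GF(s)$,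 not all zero, the first nonzero $\lambda_i$ being $1$. Let $D_F$ be the $N\times L_p$ matrix with rows $uF$, $u\in V_{n-k}$ (same ordering of $u$ as in $D_T$). One writes $D=(D_T,D_F)$. Wordlength patterns. Let $wt$ denote the Hamming weight. $A_{i,0}(D)$ is the number of words of length $i$ in the treatment defining contrast subgroup (counted up to nonzero scalar multiples), i.e. $A_{i,0}(D)=(s-1)^{-1}\#\{w\in V_n: Tw'=0,\ wt(w)=i\}$ (so $A_{0,0}=1/(s-1)$). $A_{i,1}(D)$ is the number of treatment words of length $i$ confounded with block effects, i.e. $A_{i,1}(D)=(s-1)^{-1}\#\{(w_1,w_2)\in V_n\times V_{L_p}: Tw_1'+Fw_2'=0,\ wt(w_1)=i,\ wt(w_2)=1\}$ (so $A_{0,1}=0$). Moments. $K_{t,1}(D)=N^{-2}\sum_{i=1}^N\sum_{j=1}^N[\delta_{ij}(D_T)]^t\,\delta_{ij}(D_F)$, where $\delta_{ij}(M)$ is the number of coordinates in which the $i$th and $j$th rows of the matrix $M$ coincide, and $0^0=1$. Constants. $S(m,j)$ is the Stirling number of the second kind (with $S(0,0)=1$), and $\binom{x}{m}=x(x-1)\cdots(x-m+1)/m!$ for $m>0$, $\binom{x}{0}=1$, $\binom{x}{m}=0$ for $m<0$. *)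

theory Defs
  imports "HOL-Library.Cardinality" "Jordan_Normal_Form.DL_Rank" "HOL-Combinatorics.Stirling"
begin

text \<open>
  \<open>GF(s)\<close> is an arbitrary type of class \<open>{field, finite}\<close> with \<open>s = CARD('a)\<close>.
  Vectors carry no orientation, so the row vector \<open>uT\<close> is written \<open>T\<^sup>T *\<^sub>v u\<close>.
\<close>

definition enumerates :: "'b list \<Rightarrow> 'b set \<Rightarrow> bool" where
  "enumerates xs A \<longleftrightarrow> distinct xs \<and> set xs = A"

definition regular_block_design ::
    "nat \<Rightarrow> nat \<Rightarrow> nat \<Rightarrow> 'a::{field, finite} mat \<Rightarrow> 'a mat \<Rightarrow> bool" where
  "regular_block_design n k p T B \<longleftrightarrow>
     T \<in> carrier_mat (n - k) n \<and> vec_space.rank (n - k) T = n - k \<and>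
     B \<in> carrier_mat (n - k) p \<and> vec_space.rank (n - k) B = p"

definition normalised_vecs :: "nat \<Rightarrow> 'a::{field, finite} vec set" where
  "normalised_vecs p = {l \<in> carrier_vec p. \<exists>i<p. l $ i = 1 \<and> (\<forall>j<i. l $ j = 0)}"

text \<open>
  For \<open>ls\<close> an enumeration of \<open>normalised_vecs p\<close>, this is the matrix \<open>F\<close>, with
  \<open>L_p\<close> columns; the order of its columns is that of \<open>ls\<close>.
\<close>

definition block_matrix :: "'a::{field, finite} mat \<Rightarrow> 'a vec list \<Rightarrow> 'a mat" where
  "block_matrix B ls = mat_of_cols (dim_row B) (map (\<lambda>l. B *\<^sub>v l) ls)"

definition design_matrix :: "'a::{field, finite} mat \<Rightarrow> 'a vec list \<Rightarrow> 'a mat" where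
  "design_matrix M us = mat_of_rows (dim_col M) (map (\<lambda>u. M\<^sup>T *\<^sub>v u) us)"

definition wt :: "'a::zero vec \<Rightarrow> nat" where
  "wt v = card {i. i < dim_vec v \<and> v $ i \<noteq> 0}"

definition A0 :: "'a::{field, finite} mat \<Rightarrow> nat \<Rightarrow> real" where
  "A0 T i =
     real (card {w \<in> carrier_vec (dim_col T). T *\<^sub>v w = 0\<^sub>v (dim_row T) \<and> wt w = i})
       / (real CARD('a) - 1)"

definition A1 :: "'a::{field, finite} mat \<Rightarrow> 'a mat \<Rightarrow> nat \<Rightarrow> real" where
  "A1 T F i =
     real (card {(w1, w2). w1 \<in> carrier_vec (dim_col T) \<and> w2 \<in> carrier_vec (dim_col F) \<and>
                   T *\<^sub>v w1 + F *\<^sub>v w2 = 0\<^sub>v (dim_row T) \<and> wt w1 = i \<and> wt w2 = 1})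
       / (real CARD('a) - 1)"

definition coincidences :: "'a mat \<Rightarrow> nat \<Rightarrow> nat \<Rightarrow> nat" where
  "coincidences M i j = card {c. c < dim_col M \<and> M $$ (i, c) = M $$ (j, c)}"

definition K1 :: "nat \<Rightarrow> 'a mat \<Rightarrow> 'a mat \<Rightarrow> real" where
  "K1 t DT DF =
     (\<Sum>i<dim_row DT. \<Sum>j<dim_row DT.
        real (coincidences DT i j) ^ t * real (coincidences DF i j)) / (real (dim_row DT))\<^sup>2"

definition L_num :: "nat \<Rightarrow> nat \<Rightarrow> real" where
  "L_num s q = (real s ^ q - 1) / (real s - 1)"

text \<open>The lower index has to be an integer: \<open>j - i\<close> may be negative below.\<close>

definition binom :: "real \<Rightarrow> int \<Rightarrow> real" where
  "binom x m = (if m < 0 then 0 else x gchoose nat m)"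

definition Q_coeff :: "nat \<Rightarrow> nat \<Rightarrow> nat \<Rightarrow> nat \<Rightarrow> real" where
  "Q_coeff m i n s =
     (- 1) ^ i * (\<Sum>j=0..m. fact j * real (Stirling m j) * real s powi (- int j) *
        (real s - 1) powi (int j - int i) * binom (real n - real i) (int j - int i))"

definition c_coeff :: "nat \<Rightarrow> nat \<Rightarrow> nat \<Rightarrow> nat \<Rightarrow> real" where
  "c_coeff t i n s =
     (real s - 1) * (\<Sum>m=0..t. (- 1) ^ m * real (t choose m) * real n ^ (t - m) * Q_coeff m i n s)"

end

theory Submission
  imports Defs "HOL-Computational_Algebra.Polynomial"
begin

text \<open>
  The theorem is a MacWilliams-type duality. Two rows of the design agree in a column exactly when
  the difference \<open>u\<close> of their labels is orthogonal to that column, so the double sum in the moment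
  collapses (\<open>sum_over_differences\<close>) and, with \<open>N = s\<^bsup>n-k\<^esup>\<close> rows and with \<open>f\<^sub>c\<close> the columns of \<open>F\<close>,
  the moment is \<open>1/N\<close> times the sum over all \<open>u\<close> of \<open>(n - wt (uT))\<^bsup>t\<^esup>\<close> times the number of \<open>c\<close>
  with \<open>u f\<^sub>c = 0\<close>.

  Let \<open>\<chi>\<close> be a nontrivial additive character of the field. The power \<open>(n - wt x)\<^bsup>t\<^esup>\<close> depends on
  \<open>x\<close> only through its weight, so its Fourier expansion has the form \<open>\<Sum>y. g (wt y) \<chi> (x \<bullet> y)\<close>;
  the point of the constants in the theorem is that \<open>(s - 1) g i\<close> is \<open>c_coeff t i n s\<close>
  (\<open>coincidence_power_expansion\<close>). To see this, compare coefficients of \<open>X\<^bsup>j\<^esup>\<close> in the expansion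
  of \<open>(1 + X)\<^bsup>wt x\<^esup>\<close>, which factors over the coordinates (\<open>weight_enumerator_expansion\<close>). This
  gives the transform of \<open>wt x choose j\<close>; Stirling numbers convert it to powers of the weight
  (\<open>wt_power_expansion\<close>), and the binomial theorem converts those to powers of \<open>n - wt x\<close>.

  Substituting \<open>x = uT\<close> and writing the condition \<open>u f\<^sub>c = 0\<close> as the mean of \<open>\<chi> (l (u f\<^sub>c))\<close> over
  \<open>l\<close>, the sum over \<open>u\<close> leaves, by orthogonality, the triples \<open>(y, c, l)\<close> with
  \<open>T y + l f\<^sub>c = 0\<close>, each weighted with \<open>g (wt y)\<close> and an overall factor \<open>1/s\<close>. The triples with
  \<open>l = 0\<close> are counted by \<open>L\<^sub>p A\<^sub>i\<^sub>,\<^sub>0\<close> and those with \<open>l \<noteq> 0\<close> by \<open>A\<^sub>i\<^sub>,\<^sub>1\<close>, in both cases up to the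
  factor \<open>s - 1\<close> (\<open>word_count_eq_wordlengths\<close>, \<open>code_moment\<close>).

  In the formal proof \<open>\<chi>\<close> is replaced by the integer-valued function \<open>pseudo_character\<close>.
\<close>

section \<open>A ring-valued substitute for an additive character\<close>

text \<open>
  Two properties of a nontrivial additive character carry the whole argument: its value at \<open>0\<close> is
  \<open>1\<close>, and its sum over the line \<open>b + c z\<close> vanishes unless \<open>c = 0\<close>. Every function with value \<open>1\<close>
  at \<open>0\<close> and total sum \<open>0\<close> has both. This one has integer values, which avoids complex roots of
  unity and the structure of the additive group of the field.
\<close>

definition pseudo_character :: "'a::field \<Rightarrow> 'b::comm_ring_1" where
  "pseudo_character a = of_bool (a = 0) - of_bool (a = 1)"

lemma pseudo_character_0 [simp]: "pseudo_character 0 = 1"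
  by (simp add: pseudo_character_def)

lemma sum_pseudo_character_line:
  fixes b c :: "'a::{field, finite}"
  shows "(\<Sum>z\<in>UNIV. pseudo_character (b + c * z) :: 'b::comm_ring_1) =
           of_nat CARD('a) * of_bool (c = 0) * pseudo_character b"
proof (cases "c = 0")
  case False
  have "bij (\<lambda>z. b + c * z)"
    by (rule o_bij[where g = "\<lambda>z. (z - b) / c"]) (use False in \<open>auto simp: fun_eq_iff field_simps\<close>)
  then have "(\<Sum>z\<in>UNIV. pseudo_character (b + c * z) :: 'b) = (\<Sum>z\<in>UNIV. pseudo_character (z::'a))"
    by (rule sum.reindex_bij_betw)
  also have "\<dots> = 0"
    by (simp add: pseudo_character_def sum_subtractf of_bool_def)
  finally show ?thesis using False by simp
qed simp

section \<open>Sums over all vectors of a given length\<close>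

lemma carrier_vec_Suc:
  "carrier_vec (Suc n) = (\<lambda>(a, v). vCons a v) ` (UNIV \<times> carrier_vec n)"
proof -
  have "v \<in> (\<lambda>(a, v). vCons a v) ` (UNIV \<times> carrier_vec n)"
    if "v \<in> carrier_vec (Suc n)" for v :: "'a vec"
    using that by (cases v) auto
  then show ?thesis by auto
qed

lemma inj_on_vCons: "inj_on (\<lambda>(a, v). vCons a v) A"
  by (auto simp: inj_on_def)

lemma carrier_vec_0: "carrier_vec 0 = {vNil}"
  by auto

lemma card_carrier_vec: "card (carrier_vec n :: 'a::finite vec set) = CARD('a) ^ n"
proof (induction n)
  case (Suc n)
  then show ?case
    by (simp add: carrier_vec_Suc card_image[OF inj_on_vCons] card_cartesian_product)
qed (simp add: carrier_vec_0)

lemma finite_carrier_vec [simp]: "finite (carrier_vec n :: 'a::finite vec set)"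
  by (rule card_ge_0_finite) (simp add: card_carrier_vec)

lemma sum_carrier_vec_Suc:
  "(\<Sum>v\<in>carrier_vec (Suc n). f v) = (\<Sum>a\<in>UNIV. \<Sum>v\<in>carrier_vec n. f (vCons a v))"
  for f :: "'a::finite vec \<Rightarrow> 'b::comm_monoid_add"
  unfolding carrier_vec_Suc sum.reindex[OF inj_on_vCons] sum.cartesian_product
  by (simp add: case_prod_unfold)

text \<open>
  The Fourier transform of a product function is the product of the one-dimensional transforms.
  For a character this would follow by factoring \<open>\<chi> (x \<bullet> y)\<close>. Here the offset \<open>b\<close> takes the place of
  multiplicativity: once the first coordinate \<open>z\<close> of \<open>y\<close> is fixed, \<open>x\<^sub>0 z\<close> is absorbed into the
  offset, which is why both the hypothesis and the induction are over all \<open>b\<close>.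
\<close>

lemma product_transform:
  fixes x :: "'a::{field, finite} vec" and h :: "nat \<Rightarrow> 'a \<Rightarrow> 'b::comm_ring_1"
  assumes "x \<in> carrier_vec n"
    and "\<And>a b. a < n \<Longrightarrow>
      (\<Sum>z\<in>UNIV. h a z * pseudo_character (b + x $ a * z)) = H a * pseudo_character b"
  shows "(\<Sum>y\<in>carrier_vec n. (\<Prod>a<n. h a (y $ a)) * pseudo_character (b + x \<bullet> y)) =
           (\<Prod>a<n. H a) * pseudo_character b"
  using assms
proof (induction n arbitrary: x b h H)
  case 0
  then show ?case by (simp add: carrier_vec_0 scalar_prod_def)
next
  case (Suc n)
  obtain c x' where x: "x = vCons c x'" "x' \<in> carrier_vec n"
    using Suc.prems(1) unfolding carrier_vec_Suc by auto
  have IH: "(\<Sum>y\<in>carrier_vec n. (\<Prod>a<n. h (Suc a) (y $ a)) * pseudo_character (b' + x' \<bullet> y)) =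
      (\<Prod>a<n. H (Suc a)) * pseudo_character b'" for b'
    using Suc.prems(2)[of "Suc _"] x by (intro Suc.IH) auto
  have "(\<Sum>y\<in>carrier_vec (Suc n). (\<Prod>a<Suc n. h a (y $ a)) * pseudo_character (b + x \<bullet> y)) =
      (\<Sum>z\<in>UNIV. h 0 z * (\<Sum>y\<in>carrier_vec n.
         (\<Prod>a<n. h (Suc a) (y $ a)) * pseudo_character ((b + c * z) + x' \<bullet> y)))"
    unfolding sum_carrier_vec_Suc prod.lessThan_Suc_shift x(1) sum_distrib_left
    by (intro sum.cong refl) (simp add: add.assoc mult.assoc)
  also have "\<dots> = (\<Prod>a<n. H (Suc a)) * (\<Sum>z\<in>UNIV. h 0 z * pseudo_character (b + c * z))"
    unfolding IH by (simp add: sum_distrib_left mult_ac)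
  also have "\<dots> = (\<Prod>a<Suc n. H a) * pseudo_character b"
    using Suc.prems(2)[of 0 b] x by (simp add: prod.lessThan_Suc_shift mult_ac del: prod.lessThan_Suc)
  finally show ?case .
qed

lemma prod_of_bool: "finite A \<Longrightarrow> (\<Prod>a\<in>A. of_bool (P a) :: 'b::comm_semiring_1) = of_bool (\<forall>a\<in>A. P a)"
  by (induction rule: finite_induct) auto

lemma pseudo_character_orthogonality:
  fixes w :: "'a::{field, finite} vec"
  assumes "w \<in> carrier_vec n"
  shows "(\<Sum>u\<in>carrier_vec n. pseudo_character (w \<bullet> u) :: 'b::comm_ring_1) =
           of_nat (CARD('a) ^ n) * of_bool (w = 0\<^sub>v n)"
proof -
  have "(w = 0\<^sub>v n) = (\<forall>a<n. w $ a = 0)"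
    using assms by (auto intro!: eq_vecI)
  then show ?thesis
    using product_transform[OF assms, of "\<lambda>_ _. 1" "\<lambda>a. of_nat CARD('a) * of_bool (w $ a = 0)" 0]
    by (auto simp: sum_pseudo_character_line prod.distrib prod_of_bool)
qed

section \<open>Fourier expansion of functions of the weight\<close>

lemma wt_le: "wt v \<le> dim_vec v"
  unfolding wt_def by (rule order.trans[OF card_mono[of "{..<dim_vec v}"]]) auto

lemma wt_le_length: "v \<in> carrier_vec n \<Longrightarrow> wt v \<le> n"
  using wt_le[of v] by simp

lemma prod_nonzero_entries:
  assumes "y \<in> carrier_vec n"
  shows "(\<Prod>a<n. if y $ a = 0 then p else q) = p ^ (n - wt y) * (q::'b::comm_monoid_mult) ^ wt y"
proof -
  have 1: "{a\<in>{..<n}. y $ a \<noteq> 0} = {i. i < dim_vec y \<and> y $ i \<noteq> 0}" (is "?N = _")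
    using assms by auto
  have "{a\<in>{..<n}. y $ a = 0} = {..<n} - ?N" by auto
  then have 2: "card {a\<in>{..<n}. y $ a = 0} = n - card ?N"
    by (simp add: card_Diff_subset subset_iff)
  have "(\<Prod>a<n. if y $ a = 0 then p else q) = p ^ card {a\<in>{..<n}. y $ a = 0} * q ^ card ?N"
    by (simp add: prod.If_cases Int_def Compl_eq)
  then show ?thesis unfolding 2 unfolding 1 wt_def .
qed

lemma pseudo_character_poly: "(pseudo_character a :: 'b::comm_ring_1 poly) = [:pseudo_character a:]"
  by (auto simp: pseudo_character_def one_pCons)

text \<open>
  An identity in \<open>\<real>[X]\<close>. The function \<open>x \<mapsto> (1 + X)\<^bsup>wt x\<^esup>\<close> is a product over the coordinates, and
  in one coordinate it is \<open>c \<mapsto> (if c = 0 then 1 else 1 + X)\<close>, whose Fourier coefficients are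
  \<open>1 + X - X/s\<close> at \<open>0\<close> and \<open>- X/s\<close> elsewhere. Keeping \<open>X\<close> formal makes the binomials
  \<open>wt x choose j\<close> available as coefficients, without any sum over sets of coordinates.
\<close>

lemma weight_enumerator_expansion:
  fixes x :: "'a::{field, finite} vec"
  assumes x: "x \<in> carrier_vec n" and s: "s = real CARD('a)"
  shows "[:1, 1:] ^ wt x =
    (\<Sum>y\<in>carrier_vec n. [:1, 1 - 1 / s:] ^ (n - wt y) * [:0, - 1 / s:] ^ wt y * [:pseudo_character (x \<bullet> y):])"
proof -
  define h :: "'a \<Rightarrow> real poly" where "h = (\<lambda>z. if z = 0 then [:1, 1 - 1 / s:] else [:0, - 1 / s:])"
  have "s \<noteq> 0" using s by simp
  \<comment> \<open>A multiple of the indicator of \<open>0\<close> plus a constant, so that its transform can be read off.\<close>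
  have h: "h z = of_bool (z = 0) * [:1, 1:] + [:0, - 1 / s:]" for z
    by (simp add: h_def one_pCons)
  have line: "(\<Sum>z\<in>UNIV. h z * pseudo_character (b + c * z)) =
      (if c = 0 then 1 else [:1, 1:]) * pseudo_character b" for b c
  proof -
    have "(\<Sum>z\<in>UNIV. h z * pseudo_character (b + c * z)) =
        (\<Sum>z\<in>UNIV. of_bool (z = 0) * ([:1, 1:] * pseudo_character (b + c * z))) +
        [:0, - 1 / s:] * (\<Sum>z\<in>UNIV. pseudo_character (b + c * z))"
      unfolding h by (simp only: distrib_right sum.distrib sum_distrib_left mult.assoc)
    also have "(\<Sum>z\<in>UNIV. of_bool (z = 0) * ([:1, 1:] * pseudo_character (b + c * z) :: real poly)) =
        [:1, 1:] * pseudo_character b"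
      by (subst sum.remove[of _ 0]) auto
    also have "[:1, 1:] * pseudo_character b + [:0, - 1 / s:] * (\<Sum>z\<in>UNIV. pseudo_character (b + c * z)) =
        ([:1, 1:] + [:0, - 1 / s:] * (of_nat CARD('a) * of_bool (c = 0))) * pseudo_character b"
      unfolding sum_pseudo_character_line by (simp only: distrib_right mult.assoc)
    also have "[:1, 1:] + [:0, - 1 / s:] * (of_nat CARD('a) * of_bool (c = 0)) =
        (if c = 0 then 1 else [:1, 1:])"
      using \<open>s \<noteq> 0\<close> by (simp add: s of_nat_poly one_pCons)
    finally show ?thesis .
  qed
  have "(\<Sum>y\<in>carrier_vec n. (\<Prod>a<n. h (y $ a)) * pseudo_character (0 + x \<bullet> y)) =
      (\<Prod>a<n. if x $ a = 0 then 1 else [:1, 1:]) * pseudo_character (0::'a)"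
    by (rule product_transform[where x = x and n = n and b = 0 and h = "\<lambda>_. h"
          and H = "\<lambda>a. if x $ a = 0 then 1 else [:1, 1:]"]) (rule x, rule line)
  then show ?thesis
    using x by (simp add: h_def prod_nonzero_entries pseudo_character_poly cong: sum.cong)
qed

text \<open>
  The Fourier coefficient, at a vector of weight \<open>i\<close>, of the function \<open>x \<mapsto> (wt x choose j)\<close> on
  vectors of length \<open>n\<close>. Up to the sign \<open>(- 1) ^ i\<close>, it is what remains of a summand of \<open>Q_coeff\<close>
  when the factor \<open>fact j * Stirling m j\<close> is removed.
\<close>

definition binomial_transform :: "nat \<Rightarrow> nat \<Rightarrow> nat \<Rightarrow> real \<Rightarrow> real" where
  "binomial_transform j i n s =
     (- 1) ^ i * s powi (- int j) * (s - 1) powi (int j - int i) * binom (real n - real i) (int j - int i)"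

lemma binomial_transform_eq_0: "j < i \<Longrightarrow> binomial_transform j i n s = 0"
  by (simp add: binomial_transform_def binom_def)

lemma coeff_one_linear_power: "coeff ([:1, c:] ^ n) j = of_nat (n choose j) * (c::'b::comm_semiring_1) ^ j"
proof (cases "j \<le> n")
  case False
  have "degree ([:1, c:] ^ n) \<le> n"
    using degree_power_le[of "[:1, c:]" n] by (simp split: if_splits)
  with False show ?thesis by (simp add: coeff_eq_0 binomial_eq_0)
qed (simp add: coeff_linear_poly_power)

lemma linear_monom_power: "[:0, c:] ^ i = monom (c ^ i :: 'b::comm_semiring_1) i"
proof -
  have "[:0, c:] = monom c 1" by (simp add: monom_Suc monom_0)
  then show ?thesis by (simp add: monom_power)
qed

lemma coeff_weight_enumerator:
  assumes "i \<le> n" and "s \<noteq> 0"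
  shows "coeff ([:1, 1 - 1 / s:] ^ (n - i) * [:0, - 1 / s:] ^ i) j = binomial_transform j i n s"
proof (cases "j < i")
  case True
  then show ?thesis by (simp add: linear_monom_power binomial_transform_eq_0 coeff_monom_mult mult.commute[of _ "monom _ _"])
next
  case False
  define d where "d = j - i"
  have j: "j = i + d" using False by (simp add: d_def)
  have "coeff ([:1, 1 - 1 / s:] ^ (n - i) * [:0, - 1 / s:] ^ i) j =
      (- 1 / s) ^ i * (real (n - i choose d) * (1 - 1 / s) ^ d)"
    using False
    by (simp add: linear_monom_power coeff_monom_mult mult.commute[of _ "monom _ _"] coeff_one_linear_power d_def)
  also have "\<dots> = binomial_transform j i n s"
  proof -
    have "s powi (- int j) = inverse (s ^ j)" by (simp add: power_int_minus)
    then have "s powi (- int j) = 1 / (s ^ i * s ^ d)" by (simp add: j power_add divide_inverse)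
    moreover have "(s - 1) powi (int j - int i) = (s - 1) ^ d"
      and "binom (real n - real i) (int j - int i) = real (n - i choose d)"
      using assms by (simp_all add: j binom_def binomial_gbinomial of_nat_diff)
    moreover have "(- 1 / s) ^ i = (- 1) ^ i / s ^ i" by (rule power_divide)
    moreover have "1 - 1 / s = (s - 1) / s" using assms by (simp add: field_simps)
    ultimately show ?thesis by (simp add: binomial_transform_def power_divide)
  qed
  finally show ?thesis .
qed

lemma binomial_wt_expansion:
  fixes x :: "'a::{field, finite} vec"
  assumes x: "x \<in> carrier_vec n"
  shows "real (wt x choose j) =
    (\<Sum>y\<in>carrier_vec n. binomial_transform j (wt y) n (real CARD('a)) * pseudo_character (x \<bullet> y))"
proof -
  have "real (wt x choose j) = coeff ([:1, 1:] ^ wt x) j"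
    by (simp add: coeff_one_linear_power)
  also have "\<dots> = (\<Sum>y\<in>carrier_vec n. binomial_transform j (wt y) n (real CARD('a)) * pseudo_character (x \<bullet> y))"
    unfolding weight_enumerator_expansion[OF x refl] coeff_sum
  proof (intro sum.cong refl)
    fix y :: "'a vec" assume "y \<in> carrier_vec n"
    then have "wt y \<le> n" using wt_le[of y] by simp
    have "coeff (p * [:c:]) j = coeff p j * c" for p and c :: real
      by (simp add: mult.commute)
    with coeff_weight_enumerator[OF \<open>wt y \<le> n\<close>, of "real CARD('a)" j]
    show "coeff ([:1, 1 - 1 / real CARD('a):] ^ (n - wt y) * [:0, - 1 / real CARD('a):] ^ wt y *
        [:pseudo_character (x \<bullet> y):]) j =
        binomial_transform j (wt y) n (real CARD('a)) * pseudo_character (x \<bullet> y)"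
      by simp
  qed
  finally show ?thesis .
qed

text \<open>
  Both sides count the maps from an \<open>m\<close>-set to a \<open>w\<close>-set, the right-hand side according to the
  size \<open>j\<close> of the image. The induction
  uses \<open>w * (w choose j) = (j + 1) * (w choose (j + 1)) + j * (w choose j)\<close>, which mirrors the
  recurrence of the Stirling numbers.
\<close>

lemma power_eq_sum_Stirling:
  "w ^ m = (\<Sum>j\<le>m. fact j * Stirling m j * (w choose j))"
proof (induction m)
  case (Suc m)
  have absorb: "w * (w choose j) = Suc j * (w choose Suc j) + j * (w choose j)" for j
    using Suc_times_binomial_eq[of w j] by (simp add: algebra_simps)
  have "w ^ Suc m = (\<Sum>j\<le>m. fact j * Stirling m j * (w * (w choose j)))"
    by (simp only: power_Suc Suc.IH sum_distrib_left mult_ac)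
  also have "\<dots> = (\<Sum>j\<le>m. fact (Suc j) * Stirling m j * (w choose Suc j)) +
      (\<Sum>j\<le>m. fact j * (j * Stirling m j) * (w choose j))"
    by (simp only: absorb distrib_left sum.distrib fact_Suc of_nat_id mult_ac)
  \<comment> \<open>The new term vanishes because \<open>Stirling m (Suc m) = 0\<close>, and the term for \<open>j = 0\<close> because of the
      factor \<open>j\<close>, so the index can be shifted to match the other sum.\<close>
  also have "(\<Sum>j\<le>m. fact j * (j * Stirling m j) * (w choose j)) =
      (\<Sum>j\<le>Suc m. fact j * (j * Stirling m j) * (w choose j))"
    by simp
  also have "\<dots> = (\<Sum>j\<le>m. fact (Suc j) * (Suc j * Stirling m (Suc j)) * (w choose Suc j))"
    by (simp only: sum.atMost_Suc_shift)
  also have "(\<Sum>j\<le>m. fact (Suc j) * Stirling m j * (w choose Suc j)) + \<dots> =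
      (\<Sum>j\<le>m. fact (Suc j) * Stirling (Suc m) (Suc j) * (w choose Suc j))"
    by (simp only: Stirling.simps distrib_left distrib_right add.commute sum.distrib)
  also have "\<dots> = (\<Sum>j\<le>Suc m. fact j * Stirling (Suc m) j * (w choose j))"
    by (simp only: sum.atMost_Suc_shift) simp
  finally show ?case .
qed simp

lemma Q_coeff_eq_binomial_transform:
  "Q_coeff m i n s = (\<Sum>j\<le>m. fact j * real (Stirling m j) * binomial_transform j i n (real s))"
  by (simp add: Q_coeff_def binomial_transform_def sum_distrib_left atLeast0AtMost mult_ac)

text \<open>
  The meaning of \<open>Q_coeff\<close>: at \<open>i\<close>, it is the Fourier coefficient of the \<open>m\<close>-th power of the weight at
  a vector of weight \<open>i\<close>.
\<close>

lemma wt_power_expansion: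
  fixes x :: "'a::{field, finite} vec"
  assumes "x \<in> carrier_vec n"
  shows "real (wt x) ^ m =
    (\<Sum>y\<in>carrier_vec n. Q_coeff m (wt y) n CARD('a) * pseudo_character (x \<bullet> y))"
proof -
  have "real (wt x) ^ m = (\<Sum>j\<le>m. fact j * real (Stirling m j) * real (wt x choose j))"
    using arg_cong[OF power_eq_sum_Stirling[of "wt x" m], of real] by simp
  also have "\<dots> = (\<Sum>j\<le>m. \<Sum>y\<in>carrier_vec n. fact j * real (Stirling m j) *
      binomial_transform j (wt y) n (real CARD('a)) * pseudo_character (x \<bullet> y))"
    by (simp add: binomial_wt_expansion[OF assms] sum_distrib_left mult.assoc)
  also have "\<dots> = (\<Sum>y\<in>carrier_vec n. Q_coeff m (wt y) n CARD('a) * pseudo_character (x \<bullet> y))"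
    by (subst sum.swap) (simp add: Q_coeff_eq_binomial_transform sum_distrib_right)
  finally show ?thesis .
qed

lemma card_field_gt_1: "1 < CARD('a::{field, finite})"
proof -
  have "card {0, 1 :: 'a} \<le> CARD('a)" by (rule card_mono) auto
  then show ?thesis by simp
qed

text \<open>
  The meaning of \<open>c_coeff\<close>: up to the factor \<open>s - 1\<close> it is the Fourier coefficient of the \<open>t\<close>-th
  power of the number of zero entries, by the binomial theorem applied to \<open>n - wt x\<close>.
\<close>

lemma coincidence_power_expansion:
  fixes x :: "'a::{field, finite} vec"
  assumes "x \<in> carrier_vec n" and s: "s = CARD('a)"
  shows "(real n - real (wt x)) ^ t =
    (\<Sum>y\<in>carrier_vec n. c_coeff t (wt y) n s / (real s - 1) * pseudo_character (x \<bullet> y))"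
proof -
  have s1: "real s - 1 \<noteq> 0" using card_field_gt_1[where 'a = 'a] s by simp
  have "(real n - real (wt x)) ^ t =
      (\<Sum>m\<le>t. (- 1) ^ m * real (t choose m) * real n ^ (t - m) * real (wt x) ^ m)"
    using binomial_ring[of "- real (wt x)" "real n" t]
    by (simp add: power_minus[of "real (wt x)"] mult_ac)
  also have "\<dots> = (\<Sum>m\<le>t. \<Sum>y\<in>carrier_vec n. (- 1) ^ m * real (t choose m) * real n ^ (t - m) *
      Q_coeff m (wt y) n s * pseudo_character (x \<bullet> y))"
    by (simp add: wt_power_expansion[OF assms(1)] s sum_distrib_left mult.assoc)
  also have "\<dots> = (\<Sum>y\<in>carrier_vec n. c_coeff t (wt y) n s / (real s - 1) * pseudo_character (x \<bullet> y))"
    using s1 by (subst sum.swap) (simp add: c_coeff_def sum_distrib_right atLeast0AtMost)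
  finally show ?thesis .
qed

text \<open>
  The \<open>t\<close>-th power of the number of zero entries is a combination of functions that depend on at
  most \<open>t\<close> coordinates each, so it has no Fourier coefficient at a vector of larger weight. This is
  why the sum over weights stops at \<open>min t n\<close>.
\<close>

lemma c_coeff_eq_0: "t < i \<Longrightarrow> c_coeff t i n s = 0"
  by (simp add: c_coeff_def Q_coeff_eq_binomial_transform binomial_transform_eq_0)

section \<open>The moment identity for a pair of generator matrices\<close>

text \<open>
  The indicator of the hyperplane \<open>f \<bullet> u = 0\<close> is itself a character sum along multiples of \<open>f\<close>,
  so it turns \<open>v\<close> into \<open>v + l f\<close>, and orthogonality over \<open>u\<close> leaves the \<open>l\<close> for which that
  vector is \<open>0\<close>.
\<close>

lemma sum_pseudo_character_hyperplane:
  fixes f v :: "'a::{field, finite} vec"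
  assumes f: "f \<in> carrier_vec r" and v: "v \<in> carrier_vec r"
  shows "(\<Sum>u\<in>carrier_vec r. of_bool (f \<bullet> u = 0) * pseudo_character (v \<bullet> u)) =
    real CARD('a) ^ r / real CARD('a) * real (card {l. v + l \<cdot>\<^sub>v f = 0\<^sub>v r})"
proof -
  have "real CARD('a) * (\<Sum>u\<in>carrier_vec r. of_bool (f \<bullet> u = 0) * pseudo_character (v \<bullet> u)) =
      (\<Sum>u\<in>carrier_vec r. \<Sum>l\<in>UNIV. pseudo_character (v \<bullet> u + (f \<bullet> u) * l))"
    by (simp only: sum_pseudo_character_line sum_distrib_left mult.assoc)
  also have "\<dots> = (\<Sum>u\<in>carrier_vec r. \<Sum>l\<in>UNIV. pseudo_character ((v + l \<cdot>\<^sub>v f) \<bullet> u))"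
    using f v by (intro sum.cong refl) (simp add: add_scalar_prod_distrib[of _ r] mult.commute)
  also have "\<dots> = (\<Sum>l\<in>UNIV. \<Sum>u\<in>carrier_vec r. pseudo_character ((v + l \<cdot>\<^sub>v f) \<bullet> u))"
    by (rule sum.swap)
  also have "\<dots> = (\<Sum>l\<in>UNIV. real (CARD('a) ^ r) * of_bool (v + l \<cdot>\<^sub>v f = 0\<^sub>v r))"
    using f v by (intro sum.cong refl pseudo_character_orthogonality) auto
  also have "\<dots> = real CARD('a) ^ r * real (card {l. v + l \<cdot>\<^sub>v f = 0\<^sub>v r})"
    by (simp flip: sum_distrib_left)
  finally show ?thesis by (simp add: field_simps)
qed

lemma weight_one_vecs:
  "{w \<in> carrier_vec q. wt w = 1} = (\<lambda>(c, l). l \<cdot>\<^sub>v unit_vec q c) ` ({..<q} \<times> (UNIV - {0::'a::field}))"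
proof (intro equalityI subsetI)
  fix w :: "'a vec" assume w: "w \<in> {w \<in> carrier_vec q. wt w = 1}"
  then obtain c where c: "{i. i < q \<and> w $ i \<noteq> 0} = {c}"
    by (auto simp: wt_def card_1_singleton_iff)
  then have "c < q" "w $ c \<noteq> 0" and "\<And>i. i < q \<Longrightarrow> i \<noteq> c \<Longrightarrow> w $ i = 0" by blast+
  then have "w = w $ c \<cdot>\<^sub>v unit_vec q c" using w by (intro eq_vecI) auto
  then show "w \<in> (\<lambda>(c, l). l \<cdot>\<^sub>v unit_vec q c) ` ({..<q} \<times> (UNIV - {0}))"
    using \<open>c < q\<close> \<open>w $ c \<noteq> 0\<close> by (intro image_eqI[of _ _ "(c, w $ c)"]) auto
next
  fix w :: "'a vec" assume "w \<in> (\<lambda>(c, l). l \<cdot>\<^sub>v unit_vec q c) ` ({..<q} \<times> (UNIV - {0}))"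
  then obtain c l where w: "w = l \<cdot>\<^sub>v unit_vec q c" "c < q" "l \<noteq> 0" by auto
  then have "{i. i < q \<and> w $ i \<noteq> 0} = {c}" by (auto split: if_splits)
  then show "w \<in> {w \<in> carrier_vec q. wt w = 1}" using w by (simp add: wt_def)
qed

lemma inj_on_weight_one_vecs:
  "inj_on (\<lambda>(c, l). l \<cdot>\<^sub>v unit_vec q c) ({..<q} \<times> (UNIV - {0::'a::field}))"
proof -
  have key: "c = d \<and> l = m"
    if "c < q" "d < q" "l \<noteq> 0" and eq: "l \<cdot>\<^sub>v unit_vec q c = m \<cdot>\<^sub>v unit_vec q d" for c d and l m :: 'a
    using arg_cong[OF eq, of "\<lambda>v. v $ c"] that(1-3) by (auto split: if_splits)
  show ?thesis
  proof (rule inj_onI)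
    fix x y :: "nat \<times> 'a"
    assume "x \<in> {..<q} \<times> (UNIV - {0})" "y \<in> {..<q} \<times> (UNIV - {0})"
      and "(case x of (c, l) \<Rightarrow> l \<cdot>\<^sub>v unit_vec q c) = (case y of (c, l) \<Rightarrow> l \<cdot>\<^sub>v unit_vec q c)"
    then show "x = y"
      using key[of "fst x" "fst y" "snd x" "snd y"]
      by (simp only: case_prod_unfold prod_eq_iff mem_Times_iff lessThan_iff Diff_iff singleton_iff) blast
  qed
qed

lemma mult_mat_unit_vec:
  fixes l :: "'a::field"
  assumes "F \<in> carrier_mat r q" and "c < q"
  shows "F *\<^sub>v (l \<cdot>\<^sub>v unit_vec q c) = l \<cdot>\<^sub>v col F c"
  using assms by (intro eq_vecI) auto

text \<open>
  The solutions of \<open>T y + l f\<^sub>c = 0\<close> with \<open>l = 0\<close> are the words of the treatment defining contrast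
  subgroup, each found once for every column \<open>f\<^sub>c\<close> of \<open>F\<close>. Those with \<open>l \<noteq> 0\<close> correspond to pairs
  of \<open>y\<close> and a vector of weight one, namely \<open>l\<close> times the \<open>c\<close>-th unit vector. This is where the
  combination \<open>A\<^sub>i\<^sub>,\<^sub>1 + L\<^sub>p A\<^sub>i\<^sub>,\<^sub>0\<close> comes from.
\<close>

lemma word_count_eq_wordlengths:
  fixes T F :: "'a::{field, finite} mat"
  assumes T: "T \<in> carrier_mat r n" and F: "F \<in> carrier_mat r q"
  shows "(\<Sum>y | y \<in> carrier_vec n \<and> wt y = i. \<Sum>c<q. real (card {l. T *\<^sub>v y + l \<cdot>\<^sub>v col F c = 0\<^sub>v r})) =
    (real CARD('a) - 1) * (A1 T F i + real q * A0 T i)"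
proof -
  define Y where "Y = {y :: 'a vec. y \<in> carrier_vec n \<and> wt y = i}"
  have finY: "finite Y" unfolding Y_def by simp
  have s1: "real CARD('a) - 1 \<noteq> 0" using card_field_gt_1[where 'a = 'a] by simp
  have zero: "T *\<^sub>v y + 0 \<cdot>\<^sub>v col F c = T *\<^sub>v y" if "c < q" for y c
    using that T F by (intro eq_vecI) auto
  have rem: "(\<Sum>l\<in>UNIV. h l) = h 0 + (\<Sum>l\<in>UNIV - {0}. h l)" for h :: "'a \<Rightarrow> real"
    by (rule sum.remove) auto
  have "(\<Sum>y\<in>Y. \<Sum>c<q. real (card {l. T *\<^sub>v y + l \<cdot>\<^sub>v col F c = 0\<^sub>v r})) =
      (\<Sum>y\<in>Y. \<Sum>c<q. \<Sum>l\<in>UNIV. of_bool (T *\<^sub>v y + l \<cdot>\<^sub>v col F c = 0\<^sub>v r))"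
    by simp
  also have "\<dots> = (\<Sum>y\<in>Y. \<Sum>c<q. of_bool (T *\<^sub>v y = 0\<^sub>v r) +
      (\<Sum>l\<in>UNIV - {0}. of_bool (T *\<^sub>v y + l \<cdot>\<^sub>v col F c = 0\<^sub>v r)))"
    by (intro sum.cong refl, subst rem) (simp add: zero)
  also have "\<dots> = real q * real (card {y\<in>Y. T *\<^sub>v y = 0\<^sub>v r}) +
      (\<Sum>y\<in>Y. \<Sum>c<q. \<Sum>l\<in>UNIV - {0}. of_bool (T *\<^sub>v y + l \<cdot>\<^sub>v col F c = 0\<^sub>v r))"
    using finY by (simp add: sum.distrib Int_def flip: sum_distrib_left)
  also have "{y\<in>Y. T *\<^sub>v y = 0\<^sub>v r} =
      {w \<in> carrier_vec (dim_col T). T *\<^sub>v w = 0\<^sub>v (dim_row T) \<and> wt w = i}"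
    using T by (auto simp: Y_def)
  also have "real (card \<dots>) = (real CARD('a) - 1) * A0 T i"
    using s1 by (simp add: A0_def)
  also have "(\<Sum>y\<in>Y. \<Sum>c<q. \<Sum>l\<in>UNIV - {0}. of_bool (T *\<^sub>v y + l \<cdot>\<^sub>v col F c = 0\<^sub>v r)) =
      (\<Sum>y\<in>Y. \<Sum>w | w \<in> carrier_vec q \<and> wt w = 1. of_bool (T *\<^sub>v y + F *\<^sub>v w = 0\<^sub>v r))"
    unfolding weight_one_vecs sum.reindex[OF inj_on_weight_one_vecs] sum.cartesian_product
    by (intro sum.cong refl) (auto simp: mult_mat_unit_vec[OF F])
  also have "\<dots> = real (card {(y, w). (y, w) \<in> Y \<times> {w \<in> carrier_vec q. wt w = 1} \<and>
      T *\<^sub>v y + F *\<^sub>v w = 0\<^sub>v r})"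
    unfolding sum.cartesian_product using finY
    by (simp add: case_prod_unfold Int_def) (intro arg_cong[of _ _ card], auto)
  also have "{(y, w). (y, w) \<in> Y \<times> {w \<in> carrier_vec q. wt w = 1} \<and> T *\<^sub>v y + F *\<^sub>v w = 0\<^sub>v r} =
      {(w1, w2). w1 \<in> carrier_vec (dim_col T) \<and> w2 \<in> carrier_vec (dim_col F) \<and>
         T *\<^sub>v w1 + F *\<^sub>v w2 = 0\<^sub>v (dim_row T) \<and> wt w1 = i \<and> wt w2 = 1}"
    using T F by (auto simp: Y_def)
  also have "real (card \<dots>) = (real CARD('a) - 1) * A1 T F i"
    using s1 by (simp add: A1_def)
  finally show ?thesis by (simp add: Y_def algebra_simps)
qed

text \<open>
  Expanding the power of the number of zeros gives a sum over words \<open>y\<close>; each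
  hyperplane \<open>f\<^sub>c \<bullet> u = 0\<close> then selects the pairs \<open>(y, l)\<close> with \<open>T y + l f\<^sub>c = 0\<close>.
\<close>

lemma code_moment:
  fixes T F :: "'a::{field, finite} mat"
  assumes T: "T \<in> carrier_mat r n" and F: "F \<in> carrier_mat r q" and s: "s = CARD('a)"
  shows "(\<Sum>u\<in>carrier_vec r. (real n - real (wt (T\<^sup>T *\<^sub>v u))) ^ t * real (card {c. c < q \<and> col F c \<bullet> u = 0})) =
    real s ^ r / real s * (\<Sum>i=0..min t n. c_coeff t i n s * (A1 T F i + real q * A0 T i))"
proof -
  define g where "g i = c_coeff t i n s / (real s - 1)" for i
  have s1: "real s - 1 \<noteq> 0" using card_field_gt_1[where 'a = 'a] s by simp
  have "(\<Sum>u\<in>carrier_vec r. (real n - real (wt (T\<^sup>T *\<^sub>v u))) ^ t * real (card {c. c < q \<and> col F c \<bullet> u = 0})) =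
      (\<Sum>u\<in>carrier_vec r. \<Sum>y\<in>carrier_vec n. \<Sum>c<q.
         g (wt y) * (of_bool (col F c \<bullet> u = 0) * pseudo_character ((T *\<^sub>v y) \<bullet> u)))"
  proof (intro sum.cong refl)
    fix u :: "'a vec" assume u: "u \<in> carrier_vec r"
    have "(real n - real (wt (T\<^sup>T *\<^sub>v u))) ^ t =
        (\<Sum>y\<in>carrier_vec n. g (wt y) * pseudo_character ((T\<^sup>T *\<^sub>v u) \<bullet> y))"
      using T u coincidence_power_expansion[OF _ s, of "T\<^sup>T *\<^sub>v u" n t] by (simp add: g_def)
    also have "\<dots> = (\<Sum>y\<in>carrier_vec n. g (wt y) * pseudo_character ((T *\<^sub>v y) \<bullet> u))"
      using T u by (intro sum.cong refl)
        (auto simp: transpose_vec_mult_scalar[OF T _ u] comm_scalar_prod[of u r])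
    finally have *: "(real n - real (wt (T\<^sup>T *\<^sub>v u))) ^ t =
        (\<Sum>y\<in>carrier_vec n. g (wt y) * pseudo_character ((T *\<^sub>v y) \<bullet> u))" .
    have "real (card {c. c < q \<and> col F c \<bullet> u = 0}) = (\<Sum>c<q. of_bool (col F c \<bullet> u = 0))"
      by (simp add: Int_def)
    then show "(real n - real (wt (T\<^sup>T *\<^sub>v u))) ^ t * real (card {c. c < q \<and> col F c \<bullet> u = 0}) =
        (\<Sum>y\<in>carrier_vec n. \<Sum>c<q. g (wt y) * (of_bool (col F c \<bullet> u = 0) * pseudo_character ((T *\<^sub>v y) \<bullet> u)))"
      unfolding * by (simp only: sum_product) (simp only: mult_ac)
  qed
  also have "\<dots> = (\<Sum>y\<in>carrier_vec n. \<Sum>c<q. g (wt y) *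
      (\<Sum>u\<in>carrier_vec r. of_bool (col F c \<bullet> u = 0) * pseudo_character ((T *\<^sub>v y) \<bullet> u)))"
    by (subst sum.swap, intro sum.cong refl, subst sum.swap) (simp only: sum_distrib_left)
  also have "\<dots> = (\<Sum>y\<in>carrier_vec n. \<Sum>c<q. g (wt y) *
      (real s ^ r / real s * real (card {l. T *\<^sub>v y + l \<cdot>\<^sub>v col F c = 0\<^sub>v r})))"
    unfolding s by (intro sum.cong refl arg_cong2[where f = "(*)"] sum_pseudo_character_hyperplane)
      (use T F in auto)
  also have "\<dots> = (\<Sum>y\<in>carrier_vec n. real s ^ r / real s *
      (g (wt y) * (\<Sum>c<q. real (card {l. T *\<^sub>v y + l \<cdot>\<^sub>v col F c = 0\<^sub>v r}))))"
    by (simp add: sum_distrib_left mult_ac)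
  also have "\<dots> = (\<Sum>i\<in>{0..n}. \<Sum>y | y \<in> carrier_vec n \<and> wt y = i. real s ^ r / real s *
      (g (wt y) * (\<Sum>c<q. real (card {l. T *\<^sub>v y + l \<cdot>\<^sub>v col F c = 0\<^sub>v r}))))"
    by (rule sum.group[symmetric]) (auto simp: wt_le_length)
  also have "\<dots> = real s ^ r / real s * (\<Sum>i\<in>{0..n}. g i *
      (\<Sum>y | y \<in> carrier_vec n \<and> wt y = i. \<Sum>c<q. real (card {l. T *\<^sub>v y + l \<cdot>\<^sub>v col F c = 0\<^sub>v r})))"
    by (simp add: sum_distrib_left)
  also have "\<dots> = real s ^ r / real s * (\<Sum>i\<in>{0..n}. c_coeff t i n s * (A1 T F i + real q * A0 T i))"
    unfolding word_count_eq_wordlengths[OF T F] using s1 by (simp add: g_def s)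
  also have "(\<Sum>i\<in>{0..n}. c_coeff t i n s * (A1 T F i + real q * A0 T i)) =
      (\<Sum>i=0..min t n. c_coeff t i n s * (A1 T F i + real q * A0 T i))"
    by (rule sum.mono_neutral_right) (auto simp: c_coeff_eq_0)
  finally show ?thesis .
qed

section \<open>Coincidence numbers of design matrices\<close>

lemma sum_over_differences:
  fixes G :: "'a::{ab_group_add, finite} vec \<Rightarrow> 'b::comm_semiring_1"
  assumes "enumerates us (carrier_vec r)"
  shows "(\<Sum>i<length us. \<Sum>j<length us. G (us ! i - us ! j)) =
    of_nat (CARD('a) ^ r) * (\<Sum>u\<in>carrier_vec r. G u)"
proof -
  have "bij_betw ((!) us) {..<length us} (carrier_vec r)"
    using assms bij_betw_nth unfolding enumerates_def by blast
  note reindex = sum.reindex_bij_betw[OF this]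
  have "(\<Sum>i<length us. \<Sum>j<length us. G (us ! i - us ! j)) =
      (\<Sum>u\<in>carrier_vec r. \<Sum>v\<in>carrier_vec r. G (u - v))"
    using reindex[of "\<lambda>u. \<Sum>j<length us. G (u - us ! j)"] reindex[of "\<lambda>v. G (_ - v)"] by simp
  also have "\<dots> = (\<Sum>u\<in>(carrier_vec r :: 'a vec set). \<Sum>v\<in>carrier_vec r. G v)"
  proof (rule sum.cong[OF refl])
    fix u :: "'a vec" assume "u \<in> carrier_vec r"
    then show "(\<Sum>v\<in>carrier_vec r. G (u - v)) = (\<Sum>v\<in>carrier_vec r. G v)"
      by (intro sum.reindex_bij_witness[of _ "\<lambda>v. u - v" "\<lambda>v. u - v"]) auto
  qed
  finally show ?thesis by (simp add: card_carrier_vec)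
qed

text \<open>
  Two rows agree in column \<open>c\<close> iff the difference of their labels is orthogonal to that column of
  the generator matrix, so coincidence numbers depend only on \<open>us ! i - us ! j\<close>.
\<close>

lemma coincidences_design_matrix:
  assumes M: "M \<in> carrier_mat r q" and us: "set us \<subseteq> carrier_vec r"
    and i: "i < length us" and j: "j < length us"
  shows "coincidences (design_matrix M us) i j = card {c. c < q \<and> col M c \<bullet> (us ! i - us ! j) = 0}"
proof -
  have c: "us ! i \<in> carrier_vec r" "us ! j \<in> carrier_vec r" using us i j by auto
  have "design_matrix M us $$ (i, c) = col M c \<bullet> us ! i"
    "design_matrix M us $$ (j, c) = col M c \<bullet> us ! j" if "c < q" for c
    using that M i j by (simp_all add: design_matrix_def mat_of_rows_def)
  moreover have "col M c \<bullet> (us ! i - us ! j) = col M c \<bullet> us ! i - col M c \<bullet> us ! j" for c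
    using M c by (intro scalar_prod_minus_distrib[of _ r]) auto
  ultimately show ?thesis
    using M unfolding coincidences_def by (intro arg_cong[of _ _ card]) (auto simp: design_matrix_def)
qed

lemma card_zero_entries_transpose:
  fixes M :: "'a::field mat"
  assumes "M \<in> carrier_mat r n"
  shows "real (card {c. c < n \<and> col M c \<bullet> u = 0}) = real n - real (wt (M\<^sup>T *\<^sub>v u))"
proof -
  have "{c. c < n \<and> col M c \<bullet> u = 0} = {..<n} - {i. i < n \<and> col M i \<bullet> u \<noteq> 0}" by auto
  moreover have "{i. i < dim_vec (M\<^sup>T *\<^sub>v u) \<and> (M\<^sup>T *\<^sub>v u) $ i \<noteq> 0} = {i. i < n \<and> col M i \<bullet> u \<noteq> 0}"
    using assms by auto
  ultimately have "card {c. c < n \<and> col M c \<bullet> u = 0} = n - wt (M\<^sup>T *\<^sub>v u)"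
    by (simp add: wt_def card_Diff_subset subset_iff)
  moreover have "wt (M\<^sup>T *\<^sub>v u) \<le> n" using wt_le[of "M\<^sup>T *\<^sub>v u"] assms by simp
  ultimately show ?thesis by (simp add: of_nat_diff)
qed

section \<open>The number of block effect columns\<close>

text \<open>
  A normalised vector starts either with its leading \<open>1\<close>, followed by anything, or with \<open>0\<close>,
  followed by a normalised vector. The count below therefore is \<open>1 + s + \<dots> + s\<^bsup>p-1\<^esup>\<close>.
\<close>

lemma normalised_vecs_Suc:
  "normalised_vecs (Suc p) = vCons 1 ` carrier_vec p \<union> vCons 0 ` normalised_vecs p"
proof -
  have vCons: "vCons a v \<in> normalised_vecs (Suc p) \<longleftrightarrow>
      (a = 1 \<and> v \<in> carrier_vec p) \<or> (a = 0 \<and> v \<in> normalised_vecs p)" for a :: 'a and v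
    unfolding normalised_vecs_def
    by (auto simp: Ex_less_Suc2 All_less_Suc2)
  show ?thesis
  proof (intro equalityI subsetI)
    fix w :: "'a vec" assume w: "w \<in> normalised_vecs (Suc p)"
    then obtain a v where v: "w = vCons a v"
      unfolding normalised_vecs_def carrier_vec_Suc by auto
    from w have "(a = 1 \<and> v \<in> carrier_vec p) \<or> (a = 0 \<and> v \<in> normalised_vecs p)"
      unfolding v vCons .
    then show "w \<in> vCons 1 ` carrier_vec p \<union> vCons 0 ` normalised_vecs p"
      unfolding v by auto
  next
    fix w :: "'a vec" assume "w \<in> vCons 1 ` carrier_vec p \<union> vCons 0 ` normalised_vecs p"
    then show "w \<in> normalised_vecs (Suc p)" using vCons by blast
  qed
qed

lemma card_normalised_vecs:
  "real (card (normalised_vecs p :: 'a::{field, finite} vec set)) = L_num CARD('a) p"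
proof (induction p)
  case 0
  show ?case by (simp add: normalised_vecs_def L_num_def)
next
  case (Suc p)
  have fin: "finite (normalised_vecs p :: 'a vec set)" by (simp add: normalised_vecs_def)
  have s1: "real CARD('a) - 1 \<noteq> 0" using card_field_gt_1[where 'a = 'a] by simp
  have "card (normalised_vecs (Suc p) :: 'a vec set) =
      CARD('a) ^ p + card (normalised_vecs p :: 'a vec set)"
    unfolding normalised_vecs_Suc using fin
    by (subst card_Un_disjoint) (auto simp: card_image inj_on_def card_carrier_vec)
  then show ?case
    using s1 Suc.IH by (simp add: L_num_def field_simps)
qed

section \<open>The first block moment of a regular design\<close>

theorem theorem1:
  fixes T B F DT DF :: "'a::{field, finite} mat"
    and us ls :: "'a vec list"
    and n k p s t :: nat
  assumes "s = CARD('a)"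
    and "1 \<le> n" and "k < n" and "1 \<le> p"
    and "regular_block_design n k p T B"
    and "enumerates us (carrier_vec (n - k))"
    and "enumerates ls (normalised_vecs p)"
    and "F = block_matrix B ls"
    and "DT = design_matrix T us"
    and "DF = design_matrix F us"
  shows "K1 t DT DF = 1 / real s * (\<Sum>i=0..min t n. c_coeff t i n s * (A1 T F i + L_num s p * A0 T i))"
proof -
  define r q where "r = n - k" and "q = length ls"
  define R where "R = (\<Sum>i=0..min t n. c_coeff t i n s * (A1 T F i + L_num s p * A0 T i))"
  have T: "T \<in> carrier_mat r n" and B: "B \<in> carrier_mat r p"
    using assms(5) by (simp_all add: regular_block_design_def r_def)
  have F: "F \<in> carrier_mat r q"
    using B unfolding assms(8) block_matrix_def q_def by (intro carrier_matI) auto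
  have q: "real q = L_num s p"
    using assms(1,7) card_normalised_vecs[of p, where 'a = 'a] distinct_card[of ls]
    by (simp add: enumerates_def q_def)
  have us: "set us = carrier_vec r" and len: "length us = s ^ r"
    using assms(1,6) card_carrier_vec[of r, where 'a = 'a] distinct_card[of us]
    by (simp_all add: enumerates_def r_def)
  have "s > 0" using assms(1) by simp
  define G where "G u = real (card {c. c < n \<and> col T c \<bullet> u = 0}) ^ t * real (card {c. c < q \<and> col F c \<bullet> u = 0})" for u
  have "(\<Sum>i<length us. \<Sum>j<length us. real (coincidences DT i j) ^ t * real (coincidences DF i j)) =
      (\<Sum>i<length us. \<Sum>j<length us. G (us ! i - us ! j))"
    unfolding assms(9,10) G_def using us
    by (intro sum.cong refl) (simp add: coincidences_design_matrix[OF T] coincidences_design_matrix[OF F])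
  also have "\<dots> = real s ^ r * (\<Sum>u\<in>carrier_vec r. G u)"
    using sum_over_differences[OF assms(6), of G] by (simp add: r_def assms(1))
  also have "(\<Sum>u\<in>carrier_vec r. G u) = real s ^ r / real s * R"
    unfolding G_def card_zero_entries_transpose[OF T] code_moment[OF T F assms(1)] q R_def ..
  finally have "K1 t DT DF = real s ^ r * (real s ^ r / real s * R) / (real s ^ r)\<^sup>2"
    by (simp add: K1_def assms(9) design_matrix_def len)
  also have "\<dots> = 1 / real s * R"
    using \<open>s > 0\<close> by (simp add: power2_eq_square)
  finally show ?thesis unfolding R_def .
qed

end
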